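(* We have $$(-y;q)_\infty=\sum_{n_1,n_2,n_3\ge 0}\frac{(-1)^{n_1}x^{n_1+n_2}y^{n_3}\,q^{3\binom{n_1}{2}+\binom{n_2}{2}+\binom{n_3}{2}+n_1n_2+n_2n_3+n_3n_1}\,(-q;q)_{n_1+n_2+n_3}}{(q^2;q^2)_{n_1}(q^2;q^2)_{n_2}(q^2;q^2)_{n_3}}.$$
   Context: The $q$-Pochhammer symbol is $(A;q)_n:=\prod_{k=0}^{n-1}(1-Aq^k)$ for $n\in\mathbb{N}\cup\{\infty\}$. Here $x,y,q$ are indeterminates, and the identity is between formal power series in $x$ and $y$ whose coefficients are formal power series in $q$. *)

theory Defs
  imports "HOL-Analysis.Analysis"
begin

text \<open>
  Formal power series in \<open>x\<close> and \<open>y\<close> over \<open>R = 'a[[q]]\<close> are modelled as \<open>R[[y]][[x]]\<close>: in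
  \<^typ>\<open>'a fps fps fps\<close> the outermost variable is \<open>x\<close>, the middle one is \<open>y\<close> and the innermost one
  is \<open>q\<close>.
\<close>

type_synonym 'a xy_series = "'a fps fps fps"

abbreviation q_var :: "'a::comm_ring_1 fps"
  where "q_var \<equiv> fps_X"

abbreviation x_var :: "'a::comm_ring_1 xy_series"
  where "x_var \<equiv> fps_X"

abbreviation y_var :: "'a::comm_ring_1 xy_series"
  where "y_var \<equiv> fps_const fps_X"

abbreviation q_const :: "'a::comm_ring_1 fps \<Rightarrow> 'a xy_series"
  where "q_const c \<equiv> fps_const (fps_const c)"

abbreviation xy_coeff :: "'a xy_series \<Rightarrow> nat \<Rightarrow> nat \<Rightarrow> 'a fps"
  where "xy_coeff F i j \<equiv> fps_nth (fps_nth F i) j"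

text \<open>
  The library topology on \<^typ>\<open>'a fps fps fps\<close> treats the coefficients of \<open>x ^ i\<close> as discrete, so
  that neither the infinite product nor the triple sum converges in it. The convergence meant for
  formal power series in \<open>x\<close> and \<open>y\<close> over \<open>'a[[q]]\<close> is that, for all \<open>i\<close> and \<open>j\<close>, the
  coefficient of \<open>x ^ i * y ^ j\<close> converges \<open>q\<close>-adically; the latter is the library topology
  on \<^typ>\<open>'a fps\<close>.
\<close>

definition xy_tendsto :: "('i \<Rightarrow> 'a::comm_ring_1 xy_series) \<Rightarrow> 'a xy_series \<Rightarrow> 'i filter \<Rightarrow> bool"
  where "xy_tendsto f L F \<longleftrightarrow>
    (\<forall>i j. ((\<lambda>n. xy_coeff (f n) i j) \<longlongrightarrow> xy_coeff L i j) F)"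

definition xy_has_sum :: "('i \<Rightarrow> 'a::comm_ring_1 xy_series) \<Rightarrow> 'a xy_series \<Rightarrow> 'i set \<Rightarrow> bool"
  where "xy_has_sum f S A \<longleftrightarrow> xy_tendsto (sum f) S (finite_subsets_at_top A)"

definition qpoch :: "'b::comm_ring_1 \<Rightarrow> 'b \<Rightarrow> nat \<Rightarrow> 'b"
  where "qpoch A q n = (\<Prod>k<n. 1 - A * q ^ k)"

definition qpoch_inf :: "'a::comm_ring_1 xy_series \<Rightarrow> 'a xy_series \<Rightarrow> 'a xy_series"
  where "qpoch_inf A q = (THE L. xy_tendsto (qpoch A q) L sequentially)"

lemma xy_tendsto_unique:
  assumes "xy_tendsto f L F" "xy_tendsto f L' F" "F \<noteq> bot"
  shows "L = L'"
proof (rule fps_ext, rule fps_ext)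
  fix i j
  show "xy_coeff L i j = xy_coeff L' i j"
    using assms tendsto_unique[of F "\<lambda>n. xy_coeff (f n) i j"]
    unfolding xy_tendsto_def by blast
qed

lemma qpoch_inf_eqI:
  assumes "xy_tendsto (qpoch A q) L sequentially"
  shows "qpoch_inf A q = L"
  unfolding qpoch_inf_def
proof (rule the_equality)
  show "xy_tendsto (qpoch A q) L sequentially"
    by (rule assms)
  show "L' = L" if "xy_tendsto (qpoch A q) L' sequentially" for L'
    by (rule xy_tendsto_unique[OF that assms sequentially_bot])
qed

lemma xy_tendsto_qpoch_inf:
  fixes A :: "'a::comm_ring_1 xy_series"
  shows "xy_tendsto (qpoch A (q_const q_var)) (qpoch_inf A (q_const q_var)) sequentially"
proof -
  define P where "P = qpoch A (q_const (q_var :: 'a fps))"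
  define L where
    "L = Abs_fps (\<lambda>i. Abs_fps (\<lambda>j. Abs_fps (\<lambda>k. fps_nth (xy_coeff (P (Suc k)) i j) k)))"
  have step: "fps_nth (xy_coeff (P (Suc n)) i j) k = fps_nth (xy_coeff (P n) i j) k"
    if "k < n" for n i j k
  proof -
    have "P (Suc n) = P n * (1 - A * q_const q_var ^ n)"
      by (simp add: P_def qpoch_def)
    also have "q_const q_var ^ n = (q_const (q_var ^ n) :: 'a xy_series)"
      by (simp only: fps_const_power)
    also have "P n * (1 - A * q_const (q_var ^ n)) = P n - q_const (q_var ^ n) * (P n * A)"
      by (simp only: right_diff_distrib mult_1_right mult_1_left mult.assoc mult.commute mult.left_commute)
    finally have "P (Suc n) = P n - q_const (q_var ^ n) * (P n * A)" .
    then show ?thesis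
      using that by (simp add: fps_X_power_mult_nth)
  qed
  have stable: "fps_nth (xy_coeff (P n) i j) k = fps_nth (xy_coeff (P (Suc k)) i j) k"
    if "n \<ge> Suc k" for n i j k
    using that by (induction n rule: dec_induct) (simp_all add: step)
  have "xy_tendsto P L sequentially"
    unfolding xy_tendsto_def
  proof (intro allI tendsto_fpsI)
    fix i j k
    show "\<forall>\<^sub>F n in sequentially. fps_nth (xy_coeff (P n) i j) k = fps_nth (xy_coeff L i j) k"
      unfolding eventually_sequentially
    proof (intro exI allI impI)
      fix n assume "Suc k \<le> n"
      show "fps_nth (xy_coeff (P n) i j) k = fps_nth (xy_coeff L i j) k"
        unfolding L_def fps_nth_Abs_fps by (rule stable) fact
    qed
  qed
  then have *: "xy_tendsto (qpoch A (q_const q_var)) L sequentially"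
    unfolding P_def .
  then show ?thesis
    unfolding qpoch_inf_eqI[OF *] .
qed

text \<open>
  The denominators \<open>(q\<^sup>2; q\<^sup>2)\<^sub>n\<close> are units of \<open>'a[[q]]\<close>, so that dividing by them with the
  library operation on \<^typ>\<open>'a fps\<close> is true division.
\<close>

lemma qpoch_q2_nth_0: "fps_nth (qpoch (q_var ^ 2) (q_var ^ 2) n :: 'a::comm_ring_1 fps) 0 = 1"
proof (induction n)
  case (Suc n)
  have "qpoch (q_var ^ 2) (q_var ^ 2) (Suc n) =
      (qpoch (q_var ^ 2) (q_var ^ 2) n * (1 - q_var ^ 2 * (q_var ^ 2) ^ n) :: 'a fps)"
    by (simp add: qpoch_def)
  with Suc.IH show ?case
    by (simp only: fps_mult_nth_0 fps_sub_nth fps_one_nth fps_nth_power_0 fps_X_nth) simp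
qed (simp add: qpoch_def)

end

theory Submission
  imports Defs
begin

text \<open>
  With \<open>m = n\<^sub>1 + n\<^sub>2\<close>, the exponent of \<open>q\<close> equals
  \<open>C(m,2) + C(n\<^sub>3,2) + m n\<^sub>3 + 2 C(n\<^sub>1,2)\<close>. Hence the coefficient of \<open>x ^ m * y ^ n\<^sub>3\<close> on
  the right is a multiple of the finite sum of
  \<open>(-1) ^ n\<^sub>1 * p ^ C(n\<^sub>1,2) / ((p;p)\<^bsub>n\<^sub>1\<^esub> (p;p)\<^bsub>m - n\<^sub>1\<^esub>)\<close>, where \<open>p = q\<^sup>2\<close>, and this sum vanishes
  for \<open>m > 0\<close> by the \<open>q\<close>-binomial theorem. The terms with \<open>m = 0\<close> form Euler's expansion
  of \<open>(-y;q)\<^sub>\<infinity>\<close>, since \<open>(-q;q)\<^sub>n / (q\<^sup>2;q\<^sup>2)\<^sub>n = 1 / (q;q)\<^sub>n\<close>.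
\<close>

lemma choose_two_Suc: "Suc n choose 2 = (n choose 2) + n"
  by (simp add: numeral_2_eq_2)

lemma choose_two_add: "(m + n) choose 2 = (m choose 2) + (n choose 2) + m * n"
  by (induction n) (simp_all add: choose_two_Suc)

lemma qpoch_0 [simp]: "qpoch A q 0 = 1"
  by (simp add: qpoch_def)

lemma qpoch_Suc: "qpoch A q (Suc n) = qpoch A q n * (1 - A * q ^ n)"
  by (simp add: qpoch_def)

lemma fps_const_qpoch: "fps_const (qpoch A q n) = qpoch (fps_const A) (fps_const q) n"
  by (induction n) (simp_all add: qpoch_Suc fps_const_mult [symmetric] fps_const_sub [symmetric]
      fps_const_power [symmetric] del: fps_const_mult fps_const_sub fps_const_power)

text \<open>
  The assumption makes \<open>e n\<close> a stand-in for \<open>1 / (p;p)\<^sub>n\<close>. The factor \<open>1 - p ^ m\<close> is there because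
  it turns every partial sum into a single term.
\<close>

lemma alternating_qbinomial_sum_eq_0:
  fixes p :: "'b::comm_ring_1" and e :: "nat \<Rightarrow> 'b"
  assumes e: "\<And>n. (1 - p ^ Suc n) * e (Suc n) = e n" and "m > 0"
  shows "(1 - p ^ m) * (\<Sum>n\<le>m. (-1) ^ n * p ^ (n choose 2) * e n * e (m - n)) = 0"
proof -
  have partial: "(1 - p ^ m) * (\<Sum>n\<le>N. (-1) ^ n * p ^ (n choose 2) * e n * e (m - n)) =
      (-1) ^ N * p ^ (Suc N choose 2) * e N * e (m - Suc N)" if "N < m" for N
    using that
  proof (induction N)
    case 0
    then have "e (m - 1) = (1 - p ^ m) * e m"
      using e[of "m - 1"] by simp
    then show ?case
      by (simp add: binomial_eq_0 mult_ac)
  next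
    case (Suc N)
    define r where "r = m - Suc (Suc N)"
    have m: "m = Suc (Suc N) + r" "m - Suc N = Suc r" "m - Suc (Suc N) = r"
      using Suc.prems by (auto simp: r_def)
    have pm: "p ^ m = p ^ Suc N * p ^ Suc r"
      by (subst m(1)) (simp add: power_add algebra_simps)
    \<comment> \<open>With these names the induction step is the identity
      \<open>(1 - a) - (1 - a * b) = - a * (1 - b)\<close>: the factor \<open>1 - a\<close> comes
      from \<open>e N\<close>, and \<open>1 - b\<close> is absorbed into \<open>e r\<close>.\<close>
    define a b u v where "a = p ^ Suc N" and "b = p ^ Suc r" and "u = e (Suc N)" and "v = e (Suc r)"
    have E: "e N = (1 - a) * u" "e r = (1 - b) * v"
      using e[of N] e[of r] by (simp_all add: a_def b_def u_def v_def)
    define s where "s = (-1) ^ N * p ^ (Suc N choose 2)"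
    have "(1 - p ^ m) * (\<Sum>n\<le>Suc N. (-1) ^ n * p ^ (n choose 2) * e n * e (m - n)) =
        s * e N * v - (1 - a * b) * (s * u * v)"
      using Suc by (simp add: distrib_left s_def m(2) pm a_def b_def u_def v_def algebra_simps)
    also have "\<dots> = - (s * a * u * e r)"
      unfolding E by (simp add: algebra_simps)
    also have "\<dots> = (-1) ^ Suc N * p ^ (Suc (Suc N) choose 2) * e (Suc N) * e (m - Suc (Suc N))"
      unfolding m(3) s_def a_def u_def choose_two_Suc[of "Suc N"] power_add by (simp add: algebra_simps)
    finally show ?case .
  qed
  \<comment> \<open>The closed form ends at \<open>N = m - 1\<close>, so the summand
    \<open>n = m\<close> is split off. By \<open>(1 - p ^ m) * e m = e M\<close> it cancels the
    closed form exactly.\<close>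
  obtain M where M: "m = Suc M"
    using \<open>m > 0\<close> by (cases m) auto
  have "(1 - p ^ m) * (\<Sum>n\<le>m. (-1) ^ n * p ^ (n choose 2) * e n * e (m - n)) =
      (-1) ^ M * p ^ (Suc M choose 2) * e M * e 0
      - (-1) ^ M * p ^ (Suc M choose 2) * ((1 - p ^ Suc M) * e (Suc M)) * e 0"
    using partial[of M] by (simp add: M distrib_left algebra_simps)
  then show ?thesis
    unfolding e by simp
qed

text \<open>The coefficient of index k is q^C(k,2) times a Gaussian binomial, and this is the ratio
  of two neighbours. It is multiplied out because \<open>1 - q ^ Suc k\<close> may be a zero
  divisor. Apart from the coefficients, \<open>n\<close> enters only through \<open>q ^ n\<close>,
  which suits a limit in \<open>n\<close>.\<close>

lemma qpoch_X_nth_Suc: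
  fixes q :: "'b::comm_ring_1"
  shows "(1 - q ^ Suc k) * fps_nth (qpoch (- fps_X) (fps_const q) n) (Suc k) =
    (q ^ k - q ^ n) * fps_nth (qpoch (- fps_X) (fps_const q) n) k"
proof -
  define c where "c n k = fps_nth (qpoch (- fps_X) (fps_const q) n) k" for n k
  have c_Suc: "c (Suc n) k = c n k + (if k = 0 then 0 else q ^ n * c n (k - 1))" for n k
  proof -
    have "qpoch (- fps_X) (fps_const q) (Suc n) = qpoch (- fps_X) (fps_const q) n
        + fps_const (q ^ n) * (fps_X * qpoch (- fps_X) (fps_const q) n)"
      by (simp add: qpoch_Suc algebra_simps)
    then show ?thesis
      by (simp add: c_def)
  qed
  have "(1 - q ^ Suc k) * c n (Suc k) = (q ^ k - q ^ n) * c n k"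
  proof (induction n arbitrary: k)
    case 0
    show ?case
      by (cases k) (simp_all add: c_def)
  next
    case (Suc n)
    show ?case
    proof (cases k)
      case 0
      define a b where "a = c n (Suc 0)" and "b = c n 0"
      define R where "R = q ^ n"
      have "(1 - q) * a = (1 - R) * b"
        using Suc.IH[of 0] by (simp add: a_def b_def R_def)
      then have "(1 - q) * (a + R * b) = (1 - R) * b + (1 - q) * (R * b)"
        by (simp add: distrib_left)
      also have "\<dots> = (1 - q * R) * b"
        by (simp add: algebra_simps)
      finally have "(1 - q) * (a + R * b) = (1 - q * R) * b" .
      then show ?thesis
        by (simp add: 0 c_Suc a_def b_def R_def)
    next
      case k: (Suc l)
      \<comment> \<open>By \<open>c_Suc\<close> the two coefficients for \<open>Suc n\<close> are
        \<open>a + R * b\<close> and \<open>b + R * d\<close>, so the induction hypothesis is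
        applied both at \<open>k\<close> and at \<open>l = k - 1\<close>.\<close>
      define a b d where "a = c n (Suc k)" and "b = c n k" and "d = c n l"
      define Q where "Q = q ^ l"
      define R where "R = q ^ n"
      have 1: "(1 - q * (q * Q)) * a = (q * Q - R) * b"
        using Suc.IH[of k] by (simp add: a_def b_def k Q_def R_def)
      have 2: "(1 - q * Q) * b = (Q - R) * d"
        using Suc.IH[of l] by (simp add: d_def b_def k Q_def R_def)
      have "(1 - q * (q * Q)) * (a + R * b) = (q * Q - R) * b + (1 - q * (q * Q)) * (R * b)"
        by (simp add: distrib_left 1)
      also have "\<dots> = (q * Q - q * R) * b + q * R * ((1 - q * Q) * b)"
        by (simp add: algebra_simps)
      also have "\<dots> = (q * Q - q * R) * (b + R * d)"
        unfolding 2 by (simp add: algebra_simps)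
      finally show ?thesis
        by (simp add: c_Suc k a_def b_def d_def Q_def R_def)
    qed
  qed
  then show ?thesis
    by (simp add: c_def)
qed

text \<open>A coefficient of a product involves only finitely many coefficients of the factors, and
  these are all eventually constant at once.\<close>

lemma tendsto_fps_mult:
  fixes f g :: "'i \<Rightarrow> 'a::comm_ring_1 fps"
  assumes "(f \<longlongrightarrow> a) F" and "(g \<longlongrightarrow> b) F"
  shows "((\<lambda>n. f n * g n) \<longlongrightarrow> a * b) F"
proof (rule tendsto_fpsI)
  fix m
  have "\<forall>\<^sub>F n in F. \<forall>l\<in>{..m}. fps_nth (f n) l = fps_nth a l \<and> fps_nth (g n) l = fps_nth b l"
    using assms by (subst eventually_ball_finite_distrib) (auto simp: tendsto_fps_iff eventually_conj_iff)
  then show "\<forall>\<^sub>F n in F. fps_nth (f n * g n) m = fps_nth (a * b) m"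
    by eventually_elim (auto simp: fps_mult_nth intro!: sum.cong)
qed

text \<open>Euler's expansion, cleared of denominators: since (q;q)_k (-q;q)_k = (q^2;q^2)_k, the
  coefficient of y^k is q^C(k,2) / (q;q)_k. It follows from a recurrence in \<open>k\<close>, the
  limit of \<open>qpoch_X_nth_Suc\<close> for n to infinity.\<close>

lemma qpoch_inf_neg_y_coeff:
  "xy_coeff (qpoch_inf (- y_var) (q_const q_var) :: 'a::comm_ring_1 xy_series) i k * qpoch (q_var\<^sup>2) (q_var\<^sup>2) k =
    (if i = 0 then q_var ^ (k choose 2) * qpoch (- q_var) q_var k else 0)"
proof -
  define c where "c n k = fps_nth (qpoch (- fps_X) (fps_const (q_var :: 'a fps)) n) k" for n k
  define L where "L i k = xy_coeff (qpoch_inf (- y_var) (q_const q_var) :: 'a xy_series) i k" for i k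
  have "xy_coeff (qpoch (- y_var) (q_const q_var) n :: 'a xy_series) i k = (if i = 0 then c n k else 0)" for n i k
    using fps_const_qpoch[of "- fps_X" "fps_const (q_var :: 'a fps)" n, symmetric]
    by (simp add: c_def fps_const_neg [symmetric] del: fps_const_neg)
  then have lim: "(\<lambda>n. if i = 0 then c n k else 0) \<longlonglongrightarrow> L i k" for i k
    using xy_tendsto_qpoch_inf[of "- y_var :: 'a xy_series"] by (simp add: xy_tendsto_def L_def)
  have L_pos: "L i k = 0" if "i > 0" for i k
    using lim[of i k] that by (simp add: LIMSEQ_const_iff)
  have lim0: "(\<lambda>n. c n k) \<longlonglongrightarrow> L 0 k" for k
    using lim[of 0 k] by simp
  have L_0: "L 0 0 = 1"
  proof -
    have "c n 0 = 1" for n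
      by (induction n) (simp_all add: c_def qpoch_Suc)
    with lim0[of 0] show ?thesis
      by (simp add: LIMSEQ_const_iff)
  qed
  have L_Suc: "(1 - q_var ^ Suc k) * L 0 (Suc k) = q_var ^ k * L 0 k" for k
  proof -
    \<comment> \<open>The powers \<open>q_var ^ n\<close> tend to 0 q-adically.\<close>
    have "(\<lambda>n. q_var ^ k - q_var ^ n :: 'a fps) \<longlonglongrightarrow> q_var ^ k"
    proof (rule tendsto_fpsI)
      fix m
      show "\<forall>\<^sub>F n in sequentially. fps_nth (q_var ^ k - q_var ^ n :: 'a fps) m = fps_nth (q_var ^ k) m"
        using eventually_gt_at_top[of m] by eventually_elim (simp add: fps_X_power_nth)
    qed
    then have "(\<lambda>n. (q_var ^ k - q_var ^ n) * c n k) \<longlonglongrightarrow> q_var ^ k * L 0 k"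
      by (intro tendsto_fps_mult lim0)
    moreover have "(\<lambda>n. (q_var ^ k - q_var ^ n) * c n k) \<longlonglongrightarrow> (1 - q_var ^ Suc k) * L 0 (Suc k)"
      unfolding c_def qpoch_X_nth_Suc [symmetric]
      unfolding c_def [symmetric] by (intro tendsto_fps_mult lim0 tendsto_const)
    ultimately show ?thesis
      by (rule LIMSEQ_unique [symmetric])
  qed
  have "L 0 k * qpoch (q_var\<^sup>2) (q_var\<^sup>2) k = q_var ^ (k choose 2) * qpoch (- q_var) q_var k" for k
  proof (induction k)
    case 0
    show ?case
      by (simp add: L_0 binomial_eq_0)
  next
    case (Suc k)
    \<comment> \<open>The new factor of (q^2;q^2) splits as \<open>(1 + t) * (1 - t)\<close>:
      \<open>L_Suc\<close> consumes \<open>1 - t\<close>, and \<open>1 + t\<close> is the next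
      factor of (-q;q).\<close>
    define t where "t = (q_var :: 'a fps) ^ Suc k"
    have 1: "1 - q_var\<^sup>2 * (q_var\<^sup>2) ^ k = (1 + t) * (1 - t)"
      by (simp add: t_def algebra_simps power2_eq_square flip: power_mult_distrib)
    have "L 0 (Suc k) * qpoch (q_var\<^sup>2) (q_var\<^sup>2) (Suc k) =
        (1 + t) * ((1 - t) * L 0 (Suc k)) * qpoch (q_var\<^sup>2) (q_var\<^sup>2) k"
      unfolding qpoch_Suc 1 by (simp only: mult_ac)
    also have "\<dots> = (1 + t) * q_var ^ k * (L 0 k * qpoch (q_var\<^sup>2) (q_var\<^sup>2) k)"
      unfolding t_def L_Suc by (simp only: mult_ac)
    also have "\<dots> = q_var ^ (Suc k choose 2) * qpoch (- q_var) q_var (Suc k)"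
      unfolding Suc.IH by (simp add: qpoch_Suc choose_two_Suc power_add t_def mult_ac)
    finally show ?case .
  qed
  then show ?thesis
    unfolding L_def [symmetric] by (simp add: L_pos)
qed


theorem theorem1p3:
  shows "xy_has_sum
    (\<lambda>(n1, n2, n3).
      q_const
        ((-1) ^ n1
          * q_var ^ (3 * (n1 choose 2) + (n2 choose 2) + (n3 choose 2) + n1 * n2 + n2 * n3 + n3 * n1)
          * qpoch (- q_var) q_var (n1 + n2 + n3)
          / (qpoch (q_var ^ 2) (q_var ^ 2) n1
              * qpoch (q_var ^ 2) (q_var ^ 2) n2
              * qpoch (q_var ^ 2) (q_var ^ 2) n3))
      * x_var ^ (n1 + n2) * y_var ^ n3)
    (qpoch_inf (- y_var) (q_const q_var) :: 'a::field xy_series)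
    (UNIV :: (nat \<times> nat \<times> nat) set)"
proof -
  define p where "p = (q_var :: 'a fps)\<^sup>2"
  define e where "e n = inverse (qpoch p p n)" for n
  define C where "C = (\<lambda>n1 n2 n3. (-1) ^ n1
      * q_var ^ (3 * (n1 choose 2) + (n2 choose 2) + (n3 choose 2) + n1 * n2 + n2 * n3 + n3 * n1)
      * qpoch (- q_var) q_var (n1 + n2 + n3) / (qpoch p p n1 * qpoch p p n2 * qpoch p p n3))"
  define t where "t = (\<lambda>(n1, n2, n3). q_const (C n1 n2 n3) * x_var ^ (n1 + n2) * y_var ^ n3)"
  define L where "L = (qpoch_inf (- y_var) (q_const q_var) :: 'a xy_series)"
  have unit: "fps_nth (qpoch p p n) 0 = 1" for n
    unfolding p_def by (rule qpoch_q2_nth_0)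
  have e_unit: "e n * qpoch p p n = 1" for n
    by (simp add: e_def unit inverse_mult_eq_1)
  have e_Suc: "(1 - p ^ Suc n) * e (Suc n) = e n" for n
  proof -
    have "(1 - p ^ Suc n) * e (Suc n) = (e n * qpoch p p n) * ((1 - p ^ Suc n) * e (Suc n))"
      by (simp add: e_unit)
    also have "\<dots> = e n * (e (Suc n) * qpoch p p (Suc n))"
      by (simp add: qpoch_Suc mult_ac)
    finally show ?thesis
      by (simp add: e_unit)
  qed
  \<comment> \<open>Everything before the last bracket depends only on \<open>n1 + n2\<close> and
    \<open>n3\<close>, hence is constant in the sum giving one coefficient.\<close>
  have C_eq: "C n1 n2 n3 = q_var ^ ((n1 + n2 choose 2) + (n3 choose 2) + (n1 + n2) * n3)
      * qpoch (- q_var) q_var (n1 + n2 + n3) * e n3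
      * ((-1) ^ n1 * p ^ (n1 choose 2) * e n1 * e n2)" for n1 n2 n3
  proof -
    have "3 * (n1 choose 2) + (n2 choose 2) + (n3 choose 2) + n1 * n2 + n2 * n3 + n3 * n1 =
        ((n1 + n2 choose 2) + (n3 choose 2) + (n1 + n2) * n3) + 2 * (n1 choose 2)"
      by (simp add: choose_two_add algebra_simps)
    then show ?thesis
      unfolding C_def p_def
      by (simp only: power_add power_mult)
        (simp add: e_def p_def fps_divide_unit fps_inverse_mult qpoch_q2_nth_0 mult_ac)
  qed
  have C_sum: "(\<Sum>n\<le>i. C n (i - n) j) = xy_coeff L i j" for i j
  proof -
    have L: "xy_coeff L i j = (if i = 0 then q_var ^ (j choose 2) * qpoch (- q_var) q_var j else 0) * e j"
      unfolding qpoch_inf_neg_y_coeff [symmetric] L_def p_def [symmetric]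
      using e_unit[of j] by (simp add: mult_ac)
    show ?thesis
    proof (cases "i = 0")
      case True
      then show ?thesis
        unfolding L by (simp add: C_eq binomial_eq_0) (simp add: e_def)
    next
      case False
      \<comment> \<open>Power series over a field form an integral domain, so the factor
        \<open>1 - p ^ i\<close> can be cancelled; for \<open>i > 0\<close> its constant term is
        1.\<close>
      have "1 - p ^ i \<noteq> 0"
      proof
        assume "1 - p ^ i = 0"
        then have "fps_nth (1 - p ^ i) 0 = 0"
          by simp
        with False show False
          by (simp add: p_def fps_nth_power_0 power_0_left)
      qed
      then have "(\<Sum>n\<le>i. (-1) ^ n * p ^ (n choose 2) * e n * e (i - n)) = 0"
        using alternating_qbinomial_sum_eq_0[of p e i, OF e_Suc] False by simp
      then show ?thesis
        using False by (simp add: L C_eq flip: sum_distrib_left)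
    qed
  qed
  have t_coeff: "xy_coeff (t (n1, n2, n3)) i j = (if n1 + n2 = i \<and> n3 = j then C n1 n2 n3 else 0)"
    for n1 n2 n3 i j
    by (simp add: t_def mult.assoc fps_const_power fps_X_power_nth fps_X_power_mult_nth)
  have "xy_has_sum t L UNIV"
    unfolding xy_has_sum_def xy_tendsto_def
  proof (intro allI)
    fix i j :: nat
    \<comment> \<open>These are exactly the index triples that contribute to x^i y^j. As there are
      finitely many, the coefficient is the same for every finite \<open>A\<close> containing
      \<open>S\<close>.\<close>
    define S where "S = (\<lambda>n. (n, i - n, j)) ` {..i}"
    have "\<forall>\<^sub>F A in finite_subsets_at_top UNIV. xy_coeff (sum t A) i j = xy_coeff L i j"
      unfolding eventually_finite_subsets_at_top
    proof (intro exI conjI allI impI)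
      show "finite S" "S \<subseteq> UNIV"
        by (simp_all add: S_def)
      fix A :: "(nat \<times> nat \<times> nat) set"
      assume A: "finite A \<and> S \<subseteq> A \<and> A \<subseteq> UNIV"
      have "xy_coeff (sum t A) i j = (\<Sum>a\<in>A. xy_coeff (t a) i j)"
        by (simp add: fps_sum_nth)
      also have "\<dots> = (\<Sum>a\<in>S. xy_coeff (t a) i j)"
        using A by (intro sum.mono_neutral_right) (auto simp: t_coeff S_def image_iff)
      also have "\<dots> = (\<Sum>n\<le>i. C n (i - n) j)"
        unfolding S_def by (subst sum.reindex) (auto simp: inj_on_def t_coeff)
      finally show "xy_coeff (sum t A) i j = xy_coeff L i j"
        by (simp add: C_sum)
    qed
    then show "((\<lambda>A. xy_coeff (sum t A) i j) \<longlongrightarrow> xy_coeff L i j) (finite_subsets_at_top UNIV)"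
      by (rule tendsto_eventually)
  qed
  then show ?thesis
    unfolding t_def C_def p_def L_def .
qed

end
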